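(* Let $a>0$, let $\mu$ be a nontrivial probability measure supported in $[a,+\infty)$, let $S(\lambda)=\int_a^\infty\frac{d\mu(t)}{t-\lambda}$, and let $\mathfrak J$ be the monic generalized Jacobi matrix associated with $\mathfrak Z(\lambda)=S(\lambda^2)$. Let $\alpha\in(0,\sqrt a)$ and let $\mathfrak J-\alpha I=\mathfrak L\mathfrak U$ be the $LU$-factorization specified in the context. Then the matrix $$\widetilde{\mathfrak J}^{(\alpha)}=\mathfrak U\mathfrak L+\alpha I$$ is the monic classical Jacobi matrix associated with the function $$\widetilde{\mathfrak F}^{(\alpha)}(\lambda)=(\lambda-\alpha)S(\lambda^2).$$ Besides, the monic orthogonal polynomials $\widetilde{\mathfrak T}^{(\alpha)}_j$ corresponding to $\widetilde{\mathfrak J}^{(\alpha)}$ are $$\widetilde{\mathfrak T}^{(\alpha)}_{2j}(\lambda)=P_j(\lambda^2),\qquad \widetilde{\mathfrak T}^{(\alpha)}_{2j+1}(\lambda)=(\lambda+\alpha)\widetilde P^{(\alpha)}_j(\lambda^2)=\frac1{\lambda-\alpha}\left(P_{j+1}(\lambda^2)-\frac{P_{j+1}(\alpha^2)}{P_j(\alpha^2)}P_j(\lambda^2)\right),\qquad j\in\mathbb Z_+,$$ where the polynomials $P_j$ correspond to the monic Jacobi matrix $J$ associated with $S$.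
   Context: $\mathbb Z_+=\{0,1,2,\dots\}$; $I$ is the identity matrix. A nontrivial probability measure has finite moments $s_j=\int t^j\,d\mu$ with $s_0=1$ and $\det(s_{j+k})_{j,k=0}^n>0$ for all $n\in\mathbb Z_+$. Its monic orthogonal polynomials satisfy $\lambda P_j=P_{j+1}+b_jP_j+c_{j-1}P_{j-1}$, $P_{-1}=0$, $P_0=1$, with $b_j\in\mathbb R$, $c_j>0$. A monic (classical) Jacobi matrix is a semi-infinite tridiagonal matrix with real diagonal $\beta_0,\beta_1,\dots$, superdiagonal entries all $1$, and positive subdiagonal $\gamma_0,\gamma_1,\dots$; its corresponding monic polynomials $Q_j$ are given by $\lambda Q_j=Q_{j+1}+\beta_jQ_j+\gamma_{j-1}Q_{j-1}$, $Q_{-1}=0$, $Q_0=1$. It is associated with a function $\Phi$ having an asymptotic expansion $\Phi(\lambda)\sim-\sum_{j\ge0}m_j\lambda^{-j-1}$ (to all orders, $\lambda\to\infty$ in each sector $\varepsilon<\arg\lambda<\pi-\varepsilon$) if the $Q_j$ are the monic orthogonal polynomials for the linear functional $\lambda^j\mapsto m_j$ on polynomials (equivalently, $\beta_j,\gamma_j$ are the coefficients of the $J$-fraction $-\cfrac{1}{\lambda-\beta_0-\cfrac{\gamma_0}{\lambda-\beta_1-\ddots}}$ of $\Phi$). The monic Jacobi matrix $J$ associated with $S$ has diagonal $b_j$ and subdiagonal $c_j$. The monic generalized Jacobi matrix associated with $\mathfrak Z(\lambda)=S(\lambda^2)$ is the block tridiagonal matrix $\mathfrak J$ with $2\times2$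 blocks: diagonal blocks $\begin{pmatrix}0&1\\ b_j&0\end{pmatrix}$, blocks $\begin{pmatrix}0&0\\1&0\end{pmatrix}$ in position $(j,j+1)$ and $\begin{pmatrix}0&0\\ c_j&0\end{pmatrix}$ in position $(j+1,j)$, $j\in\mathbb Z_+$. For $\alpha\in(0,\sqrt a)$ one has $P_j(\alpha^2)\ne0$ for all $j$. Put $\mathfrak u_j=-P_{j+1}(\alpha^2)/P_j(\alpha^2)>0$ and $\mathfrak l_{j+1}=c_j/\mathfrak u_j>0$, $j\in\mathbb Z_+$. The $LU$-factorization $\mathfrak J-\alpha I=\mathfrak L\mathfrak U$ is: $\mathfrak L$ is block lower bidiagonal with diagonal blocks $\mathfrak E_j=\begin{pmatrix}1&0\\-\alpha&1\end{pmatrix}$ and blocks $\mathfrak L_j=\begin{pmatrix}0&0\\0&\mathfrak l_j\end{pmatrix}$ in position $(j,j-1)$, $j\ge1$; $\mathfrak U$ is block upper bidiagonal with diagonal blocks $\mathfrak U_j=\begin{pmatrix}-\alpha&1\\ \mathfrak u_j&0\end{pmatrix}$ and blocks $\mathfrak D_j=\begin{pmatrix}0&0\\1&0\end{pmatrix}$ in position $(j,j+1)$, $j\ge0$. The kernel polynomials $\widetilde P^{(\alpha)}_j$ are $$\widetilde P^{(\alpha)}_j(x)=\frac{1}{x-\alpha^2}\left(P_{j+1}(x)-\frac{P_{j+1}(\alpha^2)}{P_j(\alpha^2)}P_j(x)\right).$$ *)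

theory Defs
  imports
    "HOL-Probability.Probability"
    "HOL-Library.Groups_Big_Fun"
    "HOL-Library.Landau_Symbols"
    "Jordan_Normal_Form.Determinant"
begin

definition moment :: "real measure \<Rightarrow> nat \<Rightarrow> real" where
  "moment \<mu> j = (\<integral>t. t ^ j \<partial>\<mu>)"

definition nontrivial_prob_measure :: "real measure \<Rightarrow> bool" where
  "nontrivial_prob_measure \<mu> \<longleftrightarrow>
     prob_space \<mu> \<and> sets \<mu> = sets borel \<and>
     (\<forall>j. integrable \<mu> (\<lambda>t. t ^ j)) \<and>
     (\<forall>n. Determinant.det (Matrix.mat (n + 1) (n + 1) (\<lambda>(j, k). moment \<mu> (j + k))) > 0)"

definition moment_functional :: "(nat \<Rightarrow> real) \<Rightarrow> real poly \<Rightarrow> real" where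
  "moment_functional m p = (\<Sum>i\<le>degree p. coeff p i * m i)"

definition monic_orthogonal_polys :: "(nat \<Rightarrow> real) \<Rightarrow> (nat \<Rightarrow> real poly) \<Rightarrow> bool" where
  "monic_orthogonal_polys m Q \<longleftrightarrow>
     (\<forall>j. degree (Q j) = j \<and> lead_coeff (Q j) = 1) \<and>
     (\<forall>i j. i \<noteq> j \<longrightarrow> moment_functional m (Q i * Q j) = 0) \<and>
     (\<forall>j. moment_functional m (Q j * Q j) \<noteq> 0)"

definition stieltjes_transform :: "real measure \<Rightarrow> real \<Rightarrow> complex \<Rightarrow> complex" where
  "stieltjes_transform \<mu> a z =
     set_lebesgue_integral \<mu> {a..} (\<lambda>t. 1 / (complex_of_real t - z))"

type_synonym inf_matrix = "nat \<Rightarrow> nat \<Rightarrow> real"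

definition inf_id :: inf_matrix where
  "inf_id i k = (if i = k then 1 else 0)"

text \<open>\<^const>\<open>Sum_any\<close> sums over the support of the summand (and is 0 if that is infinite);
  the product is only used for banded matrices, where the support is finite.\<close>

definition inf_mult :: "inf_matrix \<Rightarrow> inf_matrix \<Rightarrow> inf_matrix" where
  "inf_mult A B i k = Sum_any (\<lambda>r. A i r * B r k)"

text \<open>\<open>B j k\<close> is the \<open>2 \<times> 2\<close> block in block position \<open>(j, k)\<close>, given as the list of its rows.\<close>

definition block_matrix :: "(nat \<Rightarrow> nat \<Rightarrow> real list list) \<Rightarrow> inf_matrix" where
  "block_matrix B i k = B (i div 2) (k div 2) ! (i mod 2) ! (k mod 2)"

definition monic_jacobi_matrix :: "inf_matrix \<Rightarrow> bool" where
  "monic_jacobi_matrix M \<longleftrightarrow>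
     (\<forall>j. M j (Suc j) = 1) \<and> (\<forall>j. M (Suc j) j > 0) \<and>
     (\<forall>i k. Suc i < k \<or> Suc k < i \<longrightarrow> M i k = 0)"

text \<open>With \<open>\<beta>\<^sub>j = M j j\<close> and \<open>\<gamma>\<^sub>j = M (Suc j) j\<close>, the recurrence
  \<open>\<lambda> Q\<^sub>j = Q\<^sub>j\<^sub>+\<^sub>1 + \<beta>\<^sub>j Q\<^sub>j + \<gamma>\<^sub>j\<^sub>-\<^sub>1 Q\<^sub>j\<^sub>-\<^sub>1\<close> solved for \<open>Q\<^sub>j\<^sub>+\<^sub>1\<close>.\<close>

fun jacobi_poly :: "inf_matrix \<Rightarrow> nat \<Rightarrow> real poly" where
  "jacobi_poly M 0 = 1"
| "jacobi_poly M (Suc 0) = [:- M 0 0, 1:]"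
| "jacobi_poly M (Suc (Suc j)) =
     [:- M (Suc j) (Suc j), 1:] * jacobi_poly M (Suc j) - Polynomial.smult (M (Suc j) j) (jacobi_poly M j)"

text \<open>\<open>\<Phi>(z) \<sim> - \<Sum>\<^sub>j m\<^sub>j z\<^sup>-\<^sup>j\<^sup>-\<^sup>1\<close> to all orders, as \<open>z \<rightarrow> \<infinity>\<close> in every sector
  \<open>\<epsilon> < arg z < \<pi> - \<epsilon>\<close> of the upper half-plane.\<close>

definition sector_expansion :: "(complex \<Rightarrow> complex) \<Rightarrow> (nat \<Rightarrow> real) \<Rightarrow> bool" where
  "sector_expansion \<Phi> m \<longleftrightarrow>
     (\<forall>\<epsilon>. 0 < \<epsilon> \<and> \<epsilon> < pi / 2 \<longrightarrow>
       (\<forall>n. (\<lambda>z. \<Phi> z - (- (\<Sum>j\<le>n. complex_of_real (m j) / z ^ (j + 1))))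
          \<in> o[inf at_infinity (principal {z. \<epsilon> < Arg z \<and> Arg z < pi - \<epsilon>})](\<lambda>z. 1 / z ^ (n + 1))))"

definition monic_jacobi_matrix_of :: "inf_matrix \<Rightarrow> (complex \<Rightarrow> complex) \<Rightarrow> bool" where
  "monic_jacobi_matrix_of M \<Phi> \<longleftrightarrow>
     monic_jacobi_matrix M \<and>
     (\<exists>m. sector_expansion \<Phi> m \<and> monic_orthogonal_polys m (jacobi_poly M))"

text \<open>Below, \<open>J\<close> stands for the monic Jacobi matrix associated with \<open>S\<close>, so that
  \<open>b\<^sub>j = J j j\<close>, \<open>c\<^sub>j = J (Suc j) j\<close> and \<open>P\<^sub>j = jacobi_poly J j\<close>.\<close>

definition gen_jacobi_matrix :: "inf_matrix \<Rightarrow> inf_matrix" where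
  "gen_jacobi_matrix J = block_matrix (\<lambda>j k.
     if k = j then [[0, 1], [J j j, 0]]
     else if k = Suc j then [[0, 0], [1, 0]]
     else if j = Suc k then [[0, 0], [J (Suc k) k, 0]]
     else [[0, 0], [0, 0]])"

definition u_coef :: "inf_matrix \<Rightarrow> real \<Rightarrow> nat \<Rightarrow> real" where
  "u_coef J \<alpha> j = - poly (jacobi_poly J (Suc j)) (\<alpha>\<^sup>2) / poly (jacobi_poly J j) (\<alpha>\<^sup>2)"

text \<open>Only the values \<open>l_coef J \<alpha> (Suc j)\<close> occur; the value at \<open>0\<close> is a dummy.\<close>

fun l_coef :: "inf_matrix \<Rightarrow> real \<Rightarrow> nat \<Rightarrow> real" where
  "l_coef J \<alpha> 0 = 0"
| "l_coef J \<alpha> (Suc j) = J (Suc j) j / u_coef J \<alpha> j"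

definition L_factor :: "inf_matrix \<Rightarrow> real \<Rightarrow> inf_matrix" where
  "L_factor J \<alpha> = block_matrix (\<lambda>j k.
     if k = j then [[1, 0], [- \<alpha>, 1]]
     else if j = Suc k then [[0, 0], [0, l_coef J \<alpha> j]]
     else [[0, 0], [0, 0]])"

definition U_factor :: "inf_matrix \<Rightarrow> real \<Rightarrow> inf_matrix" where
  "U_factor J \<alpha> = block_matrix (\<lambda>j k.
     if k = j then [[- \<alpha>, 1], [u_coef J \<alpha> j, 0]]
     else if k = Suc j then [[0, 0], [1, 0]]
     else [[0, 0], [0, 0]])"

definition transformed_matrix :: "inf_matrix \<Rightarrow> real \<Rightarrow> inf_matrix" where
  "transformed_matrix J \<alpha> =
     (\<lambda>i k. inf_mult (U_factor J \<alpha>) (L_factor J \<alpha>) i k + \<alpha> * inf_id i k)"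

definition kernel_numerator :: "inf_matrix \<Rightarrow> real \<Rightarrow> nat \<Rightarrow> real poly" where
  "kernel_numerator J \<alpha> j =
     jacobi_poly J (Suc j)
       - Polynomial.smult (poly (jacobi_poly J (Suc j)) (\<alpha>\<^sup>2) / poly (jacobi_poly J j) (\<alpha>\<^sup>2)) (jacobi_poly J j)"

text \<open>The polynomial division is exact when \<open>P\<^sub>j(\<alpha>\<^sup>2) \<noteq> 0\<close>:
  the numerator then vanishes at \<open>\<alpha>\<^sup>2\<close>.\<close>

definition kernel_poly :: "inf_matrix \<Rightarrow> real \<Rightarrow> nat \<Rightarrow> real poly" where
  "kernel_poly J \<alpha> j = kernel_numerator J \<alpha> j div [:- \<alpha>\<^sup>2, 1:]"

end

theory Submission
  imports Defs
begin

text \<open>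
  Write \<open>L\<close> for the moment functional of \<open>\<mu>\<close>, \<open>r\<^sub>j = P\<^sub>j\<^sub>+\<^sub>1(\<alpha>\<^sup>2) / P\<^sub>j(\<alpha>\<^sup>2)\<close> and \<open>K\<^sub>j\<close> for
  the kernel polynomial, so that \<open>(x - \<alpha>\<^sup>2) K\<^sub>j = P\<^sub>j\<^sub>+\<^sub>1 - r\<^sub>j P\<^sub>j\<close>. Pairing this with the monic
  polynomial \<open>K\<^sub>j\<close> gives \<open>L((x - \<alpha>\<^sup>2) K\<^sub>j\<^sup>2) = - r\<^sub>j L(P\<^sub>j\<^sup>2)\<close>, and the left-hand side is positive
  because \<open>\<mu>\<close> lives to the right of \<open>\<alpha>\<^sup>2\<close>; hence \<open>\<uu>\<^sub>j = - r\<^sub>j > 0\<close>, and by induction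
  \<open>P\<^sub>j(\<alpha>\<^sup>2) \<noteq> 0\<close>. The product \<open>\<UU>\<LL> + \<alpha>I\<close> has the alternating diagonal \<open>-\<alpha>, \<alpha>\<close> and the
  subdiagonal \<open>\<uu>\<^sub>0, \<ll>\<^sub>1, \<uu>\<^sub>1, \<ll>\<^sub>2, \<dots>\<close>, from which the formulas for its polynomials follow.

  The expansion of \<open>(\<lambda> - \<alpha>) S(\<lambda>\<^sup>2)\<close> has the moments \<open>m\<^sub>2\<^sub>j = s\<^sub>j\<close> and \<open>m\<^sub>2\<^sub>j\<^sub>+\<^sub>1 = - \<alpha> s\<^sub>j\<close>, so its
  functional \<open>M\<close> satisfies \<open>M(A(x\<^sup>2)) = L(A)\<close> and \<open>M(x A(x\<^sup>2)) = - \<alpha> L(A)\<close>. Therefore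
  \<open>M((x + \<alpha>) A(x\<^sup>2)) = 0\<close> and \<open>M((x + \<alpha>)\<^sup>2 A(x\<^sup>2)) = L((x - \<alpha>\<^sup>2) A)\<close>, which reduces orthogonality
  with respect to \<open>M\<close> to orthogonality with respect to \<open>L\<close>.
\<close>

section \<open>Moment functionals and orthogonality to lower degrees\<close>

lemma moment_functional_eq_sum:
  assumes "degree p \<le> n"
  shows "moment_functional m p = (\<Sum>i\<le>n. coeff p i * m i)"
  unfolding moment_functional_def
  by (rule sum.mono_neutral_left) (use assms in \<open>auto simp: coeff_eq_0\<close>)

lemma moment_functional_0 [simp]: "moment_functional m 0 = 0"
  by (simp add: moment_functional_def)

lemma moment_functional_add:
  "moment_functional m (p + q) = moment_functional m p + moment_functional m q"
  by (simp add: moment_functional_eq_sum[of _ "max (degree p) (degree q)"] degree_add_le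
      sum.distrib algebra_simps)

lemma moment_functional_smult:
  "moment_functional m (Polynomial.smult c p) = c * moment_functional m p"
  by (simp add: moment_functional_eq_sum[of _ "degree p"] sum_distrib_left mult.assoc)

lemma moment_functional_diff:
  "moment_functional m (p - q) = moment_functional m p - moment_functional m q"
  using moment_functional_add[of m "p - q" q] by simp

lemma moment_functional_pCons:
  "moment_functional m (pCons c p) = c * m 0 + moment_functional (\<lambda>i. m (Suc i)) p"
proof -
  have "moment_functional m (pCons c p) = (\<Sum>i\<le>Suc (degree p). coeff (pCons c p) i * m i)"
    by (rule moment_functional_eq_sum) (simp add: degree_pCons_le)
  then show ?thesis
    by (simp add: sum.atMost_Suc_shift moment_functional_def del: sum.atMost_Suc)
qed

text \<open>The substitution moves each coefficient two places, so the shift rule applies twice per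
  step. The sequence \<open>m\<close> must vary because the induction hypothesis is used for
  \<open>m\<close> shifted by two.\<close>

lemma moment_functional_pcompose_square:
  "moment_functional m (pcompose p [:0, 0, 1:]) = moment_functional (\<lambda>i. m (2 * i)) p"
proof (induction p arbitrary: m)
  case (pCons c p)
  have "pcompose (pCons c p) [:0, 0, 1:] = pCons c (pCons 0 (pcompose p [:0, 0, 1:]))"
    by (simp add: pcompose_pCons)
  then show ?case
    by (simp add: moment_functional_pCons pCons.IH)
qed simp

text \<open>Turns the algebraic functional into an integral, so that the location of the support can
  give signs.\<close>

lemma moment_functional_moment:
  assumes "\<And>j. integrable \<mu> (\<lambda>t. t ^ j)"
  shows "integrable \<mu> (poly p)" and "moment_functional (moment \<mu>) p = (\<integral>t. poly p t \<partial>\<mu>)"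
proof -
  have poly: "poly p = (\<lambda>t. \<Sum>i\<le>degree p. coeff p i * t ^ i)"
    by (simp add: fun_eq_iff poly_altdef)
  show "integrable \<mu> (poly p)"
    unfolding poly by (intro Bochner_Integration.integrable_sum integrable_mult_right assms)
  show "moment_functional (moment \<mu>) p = (\<integral>t. poly p t \<partial>\<mu>)"
    unfolding poly moment_functional_def moment_def
    by (subst Bochner_Integration.integral_sum) (auto intro!: integrable_mult_right assms)
qed

text \<open>Subtracting \<open>coeff q n\<close> times the monic \<open>Q n\<close> lowers the bound
  on \<open>q\<close>, and the subtracted term is orthogonal to \<open>Q j\<close> because
  \<open>n < j\<close>. Bounding coefficients rather than \<open>degree\<close> makes the bottom
  case \<open>n = 0\<close> exactly \<open>q = 0\<close>.\<close>

lemma monic_orthogonal_polys_lower: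
  assumes "monic_orthogonal_polys m Q" and "n \<le> j" and "\<forall>i\<ge>n. coeff q i = 0"
  shows "moment_functional m (Q j * q) = 0"
  using assms(2,3)
proof (induction n arbitrary: q)
  case 0
  then have "q = 0" by (simp add: poly_eq_iff)
  then show ?case by simp
next
  case (Suc n)
  have deg: "degree (Q n) = n" "lead_coeff (Q n) = 1"
    and orth: "moment_functional m (Q j * Q n) = 0"
    using assms(1) Suc.prems(1) unfolding monic_orthogonal_polys_def by (blast, blast, simp)
  define r where "r = q - Polynomial.smult (coeff q n) (Q n)"
  have "coeff r i = 0" if "i \<ge> n" for i
  proof (cases "i = n")
    case True
    then show ?thesis using deg by (simp add: r_def)
  next
    case False
    then show ?thesis using deg that Suc.prems(2) by (simp add: r_def coeff_eq_0)
  qed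
  then have "moment_functional m (Q j * r) = 0"
    using Suc by simp
  moreover have "Q j * q = Q j * r + Polynomial.smult (coeff q n) (Q j * Q n)"
    by (simp add: r_def algebra_simps)
  ultimately show ?case
    using orth by (simp add: moment_functional_add moment_functional_smult)
qed

text \<open>The difference \<open>q - Q j\<close> of two monic polynomials of degree
  \<open>j\<close> has only lower terms, and \<open>Q j\<close> annihilates those.\<close>

lemma monic_orthogonal_polys_monic:
  assumes "monic_orthogonal_polys m Q" and "degree q = j" and "lead_coeff q = 1"
  shows "moment_functional m (Q j * q) = moment_functional m (Q j * Q j)"
proof -
  have deg: "degree (Q j) = j" "lead_coeff (Q j) = 1"
    using assms(1) unfolding monic_orthogonal_polys_def by blast+
  have "coeff (q - Q j) i = 0" if "i \<ge> j" for i
    using deg assms(2,3) that by (cases "i = j") (auto simp: coeff_eq_0)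
  then have "moment_functional m (Q j * (q - Q j)) = 0"
    using monic_orthogonal_polys_lower[OF assms(1) order.refl] by blast
  then show ?thesis
    by (simp add: right_diff_distrib moment_functional_diff)
qed

section \<open>Kernel polynomials and positivity of \<open>u_coef\<close>\<close>

lemma kernel_poly_mult:
  assumes "poly (jacobi_poly J j) (\<alpha>\<^sup>2) \<noteq> 0"
  shows "[:- \<alpha>\<^sup>2, 1:] * kernel_poly J \<alpha> j =
    jacobi_poly J (Suc j) + Polynomial.smult (u_coef J \<alpha> j) (jacobi_poly J j)"
proof -
  have "poly (kernel_numerator J \<alpha> j) (\<alpha>\<^sup>2) = 0"
    using assms by (simp add: kernel_numerator_def del: jacobi_poly.simps)
  then have "[:- \<alpha>\<^sup>2, 1:] dvd kernel_numerator J \<alpha> j"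
    by (simp add: poly_eq_0_iff_dvd)
  then have "[:- \<alpha>\<^sup>2, 1:] * kernel_poly J \<alpha> j = kernel_numerator J \<alpha> j"
    unfolding kernel_poly_def by (rule dvd_mult_div_cancel)
  then show ?thesis
    by (simp add: kernel_numerator_def u_coef_def del: jacobi_poly.simps)
qed

lemma kernel_poly_monic:
  assumes "poly (jacobi_poly J j) (\<alpha>\<^sup>2) \<noteq> 0"
    and "\<And>i. degree (jacobi_poly J i) = i" and "\<And>i. lead_coeff (jacobi_poly J i) = 1"
  shows "degree (kernel_poly J \<alpha> j) = j" and "lead_coeff (kernel_poly J \<alpha> j) = 1"
proof -
  let ?p = "jacobi_poly J (Suc j) + Polynomial.smult (u_coef J \<alpha> j) (jacobi_poly J j)"
  let ?K = "kernel_poly J \<alpha> j"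
  have lt: "degree (Polynomial.smult (u_coef J \<alpha> j) (jacobi_poly J j)) < degree (jacobi_poly J (Suc j))"
    using assms(2)[of j] assms(2)[of "Suc j"] degree_smult_le[of "u_coef J \<alpha> j" "jacobi_poly J j"]
    by linarith
  have p: "degree ?p = Suc j" "lead_coeff ?p = 1"
    using degree_add_eq_left[OF lt] lead_coeff_add_le[OF lt] assms(2)[of "Suc j"] assms(3)[of "Suc j"]
    by (simp_all add: add.commute del: jacobi_poly.simps)
  have "?p = [:- \<alpha>\<^sup>2, 1:] * ?K"
    using kernel_poly_mult[OF assms(1)] by simp
  then have eq: "degree ([:- \<alpha>\<^sup>2, 1:] * ?K) = Suc j" "lead_coeff ([:- \<alpha>\<^sup>2, 1:] * ?K) = 1"
    using p by metis+
  then have "?K \<noteq> 0" by auto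
  then show "degree ?K = j"
    using eq(1) by (subst (asm) degree_mult_eq) auto
  show "lead_coeff ?K = 1"
    using eq(2) by (subst (asm) lead_coeff_mult) simp
qed

lemma u_coef_pos:
  assumes mu: "\<And>j. integrable \<mu> (\<lambda>t. t ^ j)" and supp: "AE t in \<mu>. a \<le> t"
    and orth: "monic_orthogonal_polys (moment \<mu>) (jacobi_poly J)"
    and alpha: "\<alpha>\<^sup>2 < a" and nz: "poly (jacobi_poly J j) (\<alpha>\<^sup>2) \<noteq> 0"
  shows "u_coef J \<alpha> j > 0"
proof -
  define P where "P = jacobi_poly J"
  define K where "K = kernel_poly J \<alpha> j"
  define u where "u = u_coef J \<alpha> j"
  let ?L = "moment_functional (moment \<mu>)"
  note L = moment_functional_moment[OF mu]
  have deg: "degree (P i) = i" "lead_coeff (P i) = 1" for i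
    using orth unfolding monic_orthogonal_polys_def P_def by blast+
  have h: "?L (P j * P j) \<noteq> 0"
    using orth unfolding monic_orthogonal_polys_def P_def by blast
  \<comment> \<open>Orthogonality only makes this value nonzero; its sign comes from integrating a
    square.\<close>
  have "?L (P j * P j) \<ge> 0"
    unfolding L by (rule integral_nonneg_AE) auto
  with h have hpos: "?L (P j * P j) > 0" by simp
  note K = kernel_poly_monic[OF nz deg[unfolded P_def], folded K_def]
  \<comment> \<open>Being monic of degree \<open>j\<close>, \<open>K\<close> pairs with
    \<open>P j\<close> as \<open>P j\<close> itself does, and with \<open>P (Suc j)\<close> to zero.
    Hence only the \<open>u\<close> term survives in \<open>val\<close>.\<close>
  have PK: "?L (P j * K) = ?L (P j * P j)"
    using monic_orthogonal_polys_monic[OF orth K] unfolding P_def .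
  have PSK: "?L (P (Suc j) * K) = 0"
    unfolding P_def
    by (rule monic_orthogonal_polys_lower[OF orth, of "Suc j"]) (auto simp: K(1) coeff_eq_0)
  have "[:- \<alpha>\<^sup>2, 1:] * (K * K) = (P (Suc j) + Polynomial.smult u (P j)) * K"
    using kernel_poly_mult[OF nz] unfolding P_def K_def u_def by (metis mult.assoc)
  then have val: "?L ([:- \<alpha>\<^sup>2, 1:] * (K * K)) = u * ?L (P j * P j)"
    by (simp add: distrib_right moment_functional_add moment_functional_smult PK PSK)
  have nonneg: "AE t in \<mu>. 0 \<le> poly ([:- \<alpha>\<^sup>2, 1:] * (K * K)) t"
    using supp by eventually_elim (use alpha in \<open>auto intro!: mult_nonneg_nonneg
        simp flip: left_diff_distrib\<close>)
  have "u \<ge> 0"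
    using integral_nonneg_AE[OF nonneg] val hpos unfolding L(2)[symmetric] by (simp add: zero_le_mult_iff)
  \<comment> \<open>If \<open>u = 0\<close>, the nonnegative integrand (t - \<alpha>^2) K(t)^2
    vanishes almost everywhere. As t > \<alpha>^2 on the support, so does \<open>K\<close>, which
    contradicts \<open>PK\<close> with \<open>h\<close>.\<close>
  moreover have "u \<noteq> 0"
  proof
    assume "u = 0"
    then have "(\<integral>t. poly ([:- \<alpha>\<^sup>2, 1:] * (K * K)) t \<partial>\<mu>) = 0"
      using val L(2) by simp
    then have "AE t in \<mu>. poly ([:- \<alpha>\<^sup>2, 1:] * (K * K)) t = 0"
      using integral_nonneg_eq_0_iff_AE[OF L(1) nonneg] by simp
    with supp have "AE t in \<mu>. poly (P j * K) t = 0"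
    proof eventually_elim
      case (elim t)
      then have "poly K t = 0"
        using alpha by (auto simp flip: left_diff_distrib)
      then show ?case by simp
    qed
    then have "?L (P j * K) = 0"
      unfolding L(2) by (rule integral_eq_zero_AE)
    with PK h show False by simp
  qed
  ultimately show ?thesis unfolding u_def by simp
qed

text \<open>Up to sign, \<open>u_coef J \<alpha> j\<close> is the quotient of consecutive values, so
  its positivity, which needs nonvanishing at \<open>j\<close> alone, carries nonvanishing on to
  \<open>Suc j\<close>.\<close>

lemma poly_jacobi_poly_nonzero:
  assumes "\<And>j. integrable \<mu> (\<lambda>t. t ^ j)" and "AE t in \<mu>. a \<le> t"
    and "monic_orthogonal_polys (moment \<mu>) (jacobi_poly J)" and "\<alpha>\<^sup>2 < a"
  shows "poly (jacobi_poly J j) (\<alpha>\<^sup>2) \<noteq> 0"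
proof (induction j)
  case (Suc j)
  then have "u_coef J \<alpha> j \<noteq> 0"
    using u_coef_pos[OF assms] by (metis less_irrefl)
  then show ?case by (auto simp: u_coef_def)
qed simp

section \<open>Entries of the factors, and the LU factorization\<close>

lemma inf_mult_eq_sum:
  assumes "finite S" and "\<And>r. r \<notin> S \<Longrightarrow> A i r = 0"
  shows "inf_mult A B i k = (\<Sum>r\<in>S. A i r * B r k)"
  unfolding inf_mult_def using assms by (intro Sum_any.expand_superset) auto

text \<open>This is the three-term recurrence at \<alpha>^2 divided by the value of
  \<open>jacobi_poly J j\<close> there. The dummy \<open>l_coef J \<alpha> 0 = 0\<close> stands for
  the missing last term at the first index.\<close>

lemma diag_eq_u_coef:
  assumes nz: "\<And>j. poly (jacobi_poly J j) (\<alpha>\<^sup>2) \<noteq> 0"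
  shows "J j j = \<alpha>\<^sup>2 + u_coef J \<alpha> j + l_coef J \<alpha> j"
proof (cases j)
  case 0
  then show ?thesis by (simp add: u_coef_def)
next
  case (Suc i)
  let ?p = "\<lambda>j. poly (jacobi_poly J j) (\<alpha>\<^sup>2)"
  have "?p (Suc j) = (\<alpha>\<^sup>2 - J j j) * ?p j - J j i * ?p i"
    by (simp add: Suc algebra_simps)
  with nz[of j] nz[of i] show ?thesis
    unfolding Suc l_coef.simps u_coef_def
    by (simp add: divide_simps del: jacobi_poly.simps) (simp add: algebra_simps del: jacobi_poly.simps)
qed

lemma L_factor_even: "L_factor J \<alpha> (2 * j) r = (if r = 2 * j then 1 else 0)"
  by (cases "even r") (auto simp: L_factor_def block_matrix_def elim!: evenE oddE)

text \<open>The column \<open>2 * j - 1\<close> is written as \<open>Suc r = 2 * j\<close>, so that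
  this entry disappears for \<open>j = 0\<close>.\<close>

lemma L_factor_odd:
  "L_factor J \<alpha> (Suc (2 * j)) r =
    (if r = 2 * j then - \<alpha> else if r = Suc (2 * j) then 1
     else if Suc r = 2 * j then l_coef J \<alpha> j else 0)"
  by (cases "even r") (auto simp: L_factor_def block_matrix_def elim!: evenE oddE)

lemma U_factor_even:
  "U_factor J \<alpha> (2 * j) r = (if r = 2 * j then - \<alpha> else if r = Suc (2 * j) then 1 else 0)"
  by (cases "even r") (auto simp: U_factor_def block_matrix_def elim!: evenE oddE)

lemma U_factor_odd:
  "U_factor J \<alpha> (Suc (2 * j)) r =
    (if r = 2 * j then u_coef J \<alpha> j else if r = Suc (Suc (2 * j)) then 1 else 0)"
  by (cases "even r") (auto simp: U_factor_def block_matrix_def elim!: evenE oddE)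

lemma gen_jacobi_matrix_even:
  "gen_jacobi_matrix J (2 * j) r = (if r = Suc (2 * j) then 1 else 0)"
  by (cases "even r") (auto simp: gen_jacobi_matrix_def block_matrix_def elim!: evenE oddE, presburger)

text \<open>The guard \<open>Suc (Suc r) = 2 * j\<close> forces \<open>j > 0\<close>, so the
  truncated \<open>j - 1\<close> is harmless.\<close>

lemma gen_jacobi_matrix_odd:
  "gen_jacobi_matrix J (Suc (2 * j)) r =
    (if r = 2 * j then J j j else if r = Suc (Suc (2 * j)) then 1
     else if Suc (Suc r) = 2 * j then J j (j - 1) else 0)"
  by (cases "even r") (auto simp: gen_jacobi_matrix_def block_matrix_def elim!: evenE oddE)

text \<open>Even rows of \<open>L_factor\<close> are rows of the identity. In row
  \<open>Suc (2 * j)\<close>, column \<open>2 * j\<close> collects \<alpha>^2 +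
  \<open>u_coef J \<alpha> j\<close> + \<open>l_coef J \<alpha> j\<close>, the diagonal entry
  \<open>J j j\<close>; two columns to the left,
  \<open>l_coef J \<alpha> j * u_coef J \<alpha> (j - 1)\<close> is the subdiagonal entry.\<close>

lemma L_factor_mult_U_factor:
  assumes nz: "\<And>j. poly (jacobi_poly J j) (\<alpha>\<^sup>2) \<noteq> 0"
  shows "inf_mult (L_factor J \<alpha>) (U_factor J \<alpha>) i k = gen_jacobi_matrix J i k - \<alpha> * inf_id i k"
proof (cases "even i")
  case True
  then obtain j where i: "i = 2 * j" by (elim evenE)
  have "inf_mult (L_factor J \<alpha>) (U_factor J \<alpha>) i k = U_factor J \<alpha> i k"
    by (subst inf_mult_eq_sum[of "{2 * j}"]) (auto simp: i L_factor_even)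
  then show ?thesis
    by (auto simp: i U_factor_even gen_jacobi_matrix_even inf_id_def)
next
  case False
  then obtain j where i: "i = Suc (2 * j)" by (auto elim!: oddE)
  have nz': "u_coef J \<alpha> j \<noteq> 0" for j
    using nz[of j] nz[of "Suc j"] by (simp add: u_coef_def del: jacobi_poly.simps)
  show ?thesis
  proof (cases j)
    case 0
    have "inf_mult (L_factor J \<alpha>) (U_factor J \<alpha>) i k
        = - \<alpha> * U_factor J \<alpha> (2 * j) k + U_factor J \<alpha> (Suc (2 * j)) k"
      by (subst inf_mult_eq_sum[of "{2 * j, Suc (2 * j)}"])
         (auto simp: i L_factor_odd[of J \<alpha> 0, simplified] 0)
    then show ?thesis
      using diag_eq_u_coef[OF nz, of j] unfolding U_factor_even U_factor_odd i gen_jacobi_matrix_odd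
      by (auto simp: 0 inf_id_def power2_eq_square)
  next
    case (Suc n)
    have "inf_mult (L_factor J \<alpha>) (U_factor J \<alpha>) i k
        = - \<alpha> * U_factor J \<alpha> (2 * j) k + U_factor J \<alpha> (Suc (2 * j)) k
          + l_coef J \<alpha> j * U_factor J \<alpha> (Suc (2 * n)) k"
      by (subst inf_mult_eq_sum[of "{2 * j, Suc (2 * j), Suc (2 * n)}"])
         (auto simp: i L_factor_odd[of J \<alpha> "Suc n", simplified] Suc)
    then show ?thesis
      using diag_eq_u_coef[OF nz, of j] nz'[of n]
      unfolding U_factor_even U_factor_odd i gen_jacobi_matrix_odd
      by (auto simp: Suc inf_id_def power2_eq_square)
  qed
qed

section \<open>The transformed matrix and its polynomials\<close>

lemma transformed_matrix_even:
  "transformed_matrix J \<alpha> (2 * j) k =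
    (if k = 2 * j then - \<alpha> else if k = Suc (2 * j) then 1
     else if Suc k = 2 * j then l_coef J \<alpha> j else 0)"
  unfolding transformed_matrix_def
  by (subst inf_mult_eq_sum[of "{2 * j, Suc (2 * j)}"])
     (auto simp: U_factor_even L_factor_even L_factor_odd inf_id_def)

lemma transformed_matrix_odd:
  "transformed_matrix J \<alpha> (Suc (2 * j)) k =
    (if k = 2 * j then u_coef J \<alpha> j else if k = Suc (2 * j) then \<alpha>
     else if k = Suc (Suc (2 * j)) then 1 else 0)"
  \<comment> \<open>The unit entry of \<open>U_factor\<close> in this row meets row
    \<open>2 * Suc j\<close> of \<open>L_factor\<close>, again an even one.\<close>
  using L_factor_even[of J \<alpha> "Suc j"] unfolding transformed_matrix_def
  by (subst inf_mult_eq_sum[of "{2 * j, Suc (Suc (2 * j))}"])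
     (auto simp: U_factor_odd L_factor_even inf_id_def)

lemma monic_jacobi_transformed_matrix:
  assumes u: "\<And>j. u_coef J \<alpha> j > 0" and J: "monic_jacobi_matrix J"
  shows "monic_jacobi_matrix (transformed_matrix J \<alpha>)"
proof -
  have l: "l_coef J \<alpha> (Suc j) > 0" for j
    using u[of j] J by (simp add: monic_jacobi_matrix_def)
  have "transformed_matrix J \<alpha> j (Suc j) = 1 \<and> transformed_matrix J \<alpha> (Suc j) j > 0 \<and>
      (\<forall>k. Suc j < k \<or> Suc k < j \<longrightarrow> transformed_matrix J \<alpha> j k = 0)" for j
  proof (cases "even j")
    case True
    then obtain n where "j = 2 * n" by (elim evenE)
    then show ?thesis by (auto simp: transformed_matrix_even transformed_matrix_odd u)
  next
    case False
    then obtain n where "j = Suc (2 * n)" by (auto elim!: oddE)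
    moreover have "Suc (Suc (2 * n)) = 2 * Suc n" by simp
    ultimately show ?thesis
      using l[of n] by (auto simp: transformed_matrix_even[of _ _ "Suc n", simplified] transformed_matrix_odd)
  qed
  then show ?thesis by (auto simp: monic_jacobi_matrix_def)
qed

text \<open>The recurrence alternates, so both parities go through one induction. Multiplying (x +
  \<alpha>) K(x^2) by x - \<alpha> gives (x^2 - \<alpha>^2) K(x^2), a combination of the P(x^2)
  alone: this is the even step, and the odd step follows by cancelling x - \<alpha>.\<close>

lemma jacobi_poly_transformed_matrix:
  assumes nz: "\<And>j. poly (jacobi_poly J j) (\<alpha>\<^sup>2) \<noteq> 0"
  shows "jacobi_poly (transformed_matrix J \<alpha>) (2 * j) = pcompose (jacobi_poly J j) [:0, 0, 1:] \<and>
    jacobi_poly (transformed_matrix J \<alpha>) (Suc (2 * j)) =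
      [:\<alpha>, 1:] * pcompose (kernel_poly J \<alpha> j) [:0, 0, 1:]"
proof (induction j)
  case 0
  have "[:- \<alpha>\<^sup>2, 1:] * kernel_poly J \<alpha> 0 = [:- \<alpha>\<^sup>2, 1:] * 1"
    unfolding kernel_poly_mult[OF nz[of 0]] by (simp add: u_coef_def)
  then have "kernel_poly J \<alpha> 0 = 1"
    by (metis mult_cancel_left pCons_eq_0_iff zero_neq_one)
  then show ?case
    using transformed_matrix_even[of J \<alpha> 0 0] by (simp add: pcompose_1)
next
  case (Suc j)
  let ?T = "transformed_matrix J \<alpha>"
  let ?c = "\<lambda>p. pcompose p [:0, 0, 1:] :: real poly"
  let ?P = "jacobi_poly J" and ?K = "kernel_poly J \<alpha>" and ?u = "u_coef J \<alpha>"
  have K: "[:- \<alpha>, 1:] * ([:\<alpha>, 1:] * ?c (?K i)) =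
      ?c (?P (Suc i)) + Polynomial.smult (?u i) (?c (?P i))" for i
  proof -
    have "[:- \<alpha>, 1:] * ([:\<alpha>, 1:] * ?c (?K i)) = ?c ([:- \<alpha>\<^sup>2, 1:] * ?K i)"
      by (simp add: pcompose_mult pcompose_pCons power2_eq_square mult.assoc[symmetric] del: mult_pCons_left)
    then show ?thesis
      unfolding kernel_poly_mult[OF nz] by (simp only: pcompose_add pcompose_smult)
  qed
  have even: "jacobi_poly ?T (2 * Suc j) = ?c (?P (Suc j))"
  proof -
    have "jacobi_poly ?T (2 * Suc j) =
        [:- \<alpha>, 1:] * jacobi_poly ?T (Suc (2 * j)) - Polynomial.smult (?u j) (jacobi_poly ?T (2 * j))"
      by (simp add: transformed_matrix_odd)
    then show ?thesis using Suc.IH K[of j] by (simp del: mult_pCons_left)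
  qed
  have "jacobi_poly ?T (Suc (2 * Suc j)) =
      [:\<alpha>, 1:] * jacobi_poly ?T (2 * Suc j)
        - Polynomial.smult (l_coef J \<alpha> (Suc j)) (jacobi_poly ?T (Suc (2 * j)))"
    using transformed_matrix_even[of J \<alpha> "Suc j"] by (simp del: l_coef.simps)
  also have "\<dots> = [:\<alpha>, 1:] * ?c (?P (Suc j))
      - Polynomial.smult (l_coef J \<alpha> (Suc j)) ([:\<alpha>, 1:] * ?c (?K j))"
    using Suc.IH even by simp
  finally have T: "jacobi_poly ?T (Suc (2 * Suc j)) = \<dots>" .
  have unz: "?u j \<noteq> 0"
    using nz[of j] nz[of "Suc j"] by (simp add: u_coef_def del: jacobi_poly.simps)
  have "[:- \<alpha>, 1:] * jacobi_poly ?T (Suc (2 * Suc j)) =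
      [:- \<alpha>, 1:] * [:\<alpha>, 1:] * ?c (?P (Suc j))
      - Polynomial.smult (l_coef J \<alpha> (Suc j)) ([:- \<alpha>, 1:] * ([:\<alpha>, 1:] * ?c (?K j)))"
    unfolding T by (simp only: right_diff_distrib mult_smult_right mult.assoc)
  \<comment> \<open>By \<open>K\<close>, and because \<open>l_coef J \<alpha> (Suc j) * ?u j\<close>
    is \<open>J (Suc j) j\<close>.\<close>
  also have "\<dots> = [:- \<alpha>\<^sup>2, 0, 1:] * ?c (?P (Suc j))
      - Polynomial.smult (l_coef J \<alpha> (Suc j)) (?c (?P (Suc j)))
      - Polynomial.smult (J (Suc j) j) (?c (?P j))"
    using unz unfolding K by (simp add: smult_add_right power2_eq_square del: mult_pCons_left)
  \<comment> \<open>The diagonal formula trades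
    \<open>- \<alpha>\<^sup>2 - l_coef J \<alpha> (Suc j)\<close> for
    \<open>?u (Suc j) - J (Suc j) (Suc j)\<close>, which brings out the recurrence of
    \<open>J\<close>.\<close>
  also have "\<dots> = [:- J (Suc j) (Suc j), 0, 1:] * ?c (?P (Suc j))
      - Polynomial.smult (J (Suc j) j) (?c (?P j)) + Polynomial.smult (?u (Suc j)) (?c (?P (Suc j)))"
    unfolding diag_eq_u_coef[OF nz, of "Suc j"]
    by (simp add: algebra_simps smult_add_left smult_diff_left del: l_coef.simps jacobi_poly.simps)
  also have "\<dots> = ?c (?P (Suc (Suc j))) + Polynomial.smult (?u (Suc j)) (?c (?P (Suc j)))"
    unfolding jacobi_poly.simps(3)
    by (simp add: pcompose_diff pcompose_mult pcompose_smult pcompose_pCons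
        del: mult_pCons_left jacobi_poly.simps)
  also have "\<dots> = [:- \<alpha>, 1:] * ([:\<alpha>, 1:] * ?c (?K (Suc j)))"
    by (rule K[symmetric])
  finally have "jacobi_poly ?T (Suc (2 * Suc j)) = [:\<alpha>, 1:] * ?c (?K (Suc j))"
    by (subst (asm) mult_cancel_left) simp
  with even show ?case by simp
qed

section \<open>Orthogonality with respect to the transformed moments\<close>

lemma jacobi_poly_monic:
  shows "degree (jacobi_poly M j) = j" and "lead_coeff (jacobi_poly M j) = 1"
proof -
  \<comment> \<open>Coefficients pass through the recurrence linearly, unlike
    \<open>degree\<close>.\<close>
  have *: "coeff (jacobi_poly M j) j = 1 \<and> (\<forall>i>j. coeff (jacobi_poly M j) i = 0)"
  proof (induction M j rule: jacobi_poly.induct)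
    case (3 M j)
    have eq: "coeff (jacobi_poly M (Suc (Suc j))) (Suc i) =
        coeff (jacobi_poly M (Suc j)) i - M (Suc j) (Suc j) * coeff (jacobi_poly M (Suc j)) (Suc i)
          - M (Suc j) j * coeff (jacobi_poly M j) (Suc i)" for i
      by simp
    show ?case
    proof (intro conjI allI impI)
      show "coeff (jacobi_poly M (Suc (Suc j))) (Suc (Suc j)) = 1"
        unfolding eq using 3 by (simp del: jacobi_poly.simps)
    next
      fix i
      assume "Suc (Suc j) < i"
      then obtain k where "i = Suc k" "Suc j < k" by (cases i) auto
      then show "coeff (jacobi_poly M (Suc (Suc j))) i = 0"
        using 3 by (simp add: eq del: jacobi_poly.simps)
    qed
  qed (auto simp: coeff_pCons split: nat.splits)
  then have "degree (jacobi_poly M j) \<le> j" and "j \<le> degree (jacobi_poly M j)"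
    by (auto intro: degree_le le_degree)
  then show "degree (jacobi_poly M j) = j" by simp
  with * show "lead_coeff (jacobi_poly M j) = 1" by simp
qed

lemma monic_orthogonal_polys_transformed_matrix:
  assumes orth: "monic_orthogonal_polys s (jacobi_poly J)"
    and nz: "\<And>j. poly (jacobi_poly J j) (\<alpha>\<^sup>2) \<noteq> 0"
    and m: "\<And>i. m (2 * i) = s i" "\<And>i. m (Suc (2 * i)) = - \<alpha> * s i"
  shows "monic_orthogonal_polys m (jacobi_poly (transformed_matrix J \<alpha>))"
proof -
  let ?L = "moment_functional s" and ?M = "moment_functional m"
  let ?T = "jacobi_poly (transformed_matrix J \<alpha>)"
  let ?c = "\<lambda>p. pcompose p [:0, 0, 1:] :: real poly"
  let ?P = "jacobi_poly J" and ?K = "kernel_poly J \<alpha>"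
  have hP: "?L (?P i * ?P j) = 0 \<longleftrightarrow> i \<noteq> j" for i j
    using orth unfolding monic_orthogonal_polys_def by blast
  have T: "?T (2 * j) = ?c (?P j)" "?T (Suc (2 * j)) = [:\<alpha>, 1:] * ?c (?K j)" for j
    using jacobi_poly_transformed_matrix[OF nz] by blast+
  have even: "?M (?c p) = ?L p" for p
    by (simp add: moment_functional_pcompose_square m)
  have odd: "?M (pCons 0 (?c p)) = - \<alpha> * ?L p" for p
    by (simp add: moment_functional_pCons moment_functional_pcompose_square m)
       (simp add: moment_functional_def sum_distrib_left algebra_simps sum_negf)
  have ee: "?M (?T (2 * i) * ?T (2 * j)) = ?L (?P i * ?P j)" for i j
    unfolding T by (simp only: pcompose_mult[symmetric] even)
  have oe: "?M (?T (Suc (2 * i)) * ?T (2 * j)) = 0" for i j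
  proof -
    have "?T (Suc (2 * i)) * ?T (2 * j) =
        Polynomial.smult \<alpha> (?c (?K i * ?P j)) + pCons 0 (?c (?K i * ?P j))"
      unfolding T by (simp add: pcompose_mult algebra_simps)
    then show ?thesis
      by (simp add: moment_functional_add moment_functional_smult even odd)
  qed
  have oo: "?M (?T (Suc (2 * i)) * ?T (Suc (2 * j))) = ?L ([:- \<alpha>\<^sup>2, 1:] * ?K i * ?K j)" for i j
  proof -
    let ?A = "?K i * ?K j"
    \<comment> \<open>The square (x + \<alpha>)^2 splits into its even part x^2 + \<alpha>^2 and its
      odd part 2 \<alpha> x; the odd part contributes -2 \<alpha>^2, which flips the sign of
      \<alpha>^2.\<close>
    have "?T (Suc (2 * i)) * ?T (Suc (2 * j)) = [:\<alpha>\<^sup>2, 2 * \<alpha>, 1:] * ?c ?A"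
      unfolding T by (simp add: pcompose_mult algebra_simps power2_eq_square smult_add_left[symmetric])
    also have "\<dots> = ?c ([:\<alpha>\<^sup>2, 1:] * ?A) + Polynomial.smult (2 * \<alpha>) (pCons 0 (?c ?A))"
      by (simp add: pcompose_add pcompose_mult pcompose_smult pcompose_pCons algebra_simps)
    finally have "?M (?T (Suc (2 * i)) * ?T (Suc (2 * j))) =
        ?L ([:\<alpha>\<^sup>2, 1:] * ?A) - 2 * \<alpha>\<^sup>2 * ?L ?A"
      by (simp only: moment_functional_add moment_functional_smult even odd)
         (simp add: power2_eq_square)
    also have "\<dots> = ?L ([:\<alpha>\<^sup>2, 1:] * ?A - Polynomial.smult (2 * \<alpha>\<^sup>2) ?A)"
      by (simp only: moment_functional_diff moment_functional_smult)
    also have "[:\<alpha>\<^sup>2, 1:] * ?A - Polynomial.smult (2 * \<alpha>\<^sup>2) ?A = [:- \<alpha>\<^sup>2, 1:] * ?K i * ?K j"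
      by (simp add: algebra_simps smult_add_left[symmetric] smult_diff_left[symmetric])
    finally show ?thesis .
  qed
  note K = kernel_poly_monic[OF nz jacobi_poly_monic]
  have KK: "?L ([:- \<alpha>\<^sup>2, 1:] * ?K i * ?K j) =
      ?L (?P (Suc i) * ?K j) + u_coef J \<alpha> i * ?L (?P i * ?K j)" for i j
    unfolding kernel_poly_mult[OF nz]
    by (simp add: distrib_right moment_functional_add moment_functional_smult del: jacobi_poly.simps)
  have low: "?L (?P i * ?K j) = 0" if "j < i" for i j
    by (rule monic_orthogonal_polys_lower[OF orth, of i]) (use that K(1)[of j] in \<open>auto intro: coeff_eq_0\<close>)
  have eq: "?L (?P i * ?K i) = ?L (?P i * ?P i)" for i
    by (rule monic_orthogonal_polys_monic[OF orth K])
  have u: "u_coef J \<alpha> i \<noteq> 0" for i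
    using nz[of i] nz[of "Suc i"] by (simp add: u_coef_def del: jacobi_poly.simps)
  \<comment> \<open>\<open>KK\<close> is applied to the kernel polynomial of larger index, hence the
    swap for \<open>i < j\<close>. On the diagonal only
    \<open>u_coef J \<alpha> i * ?L (?P i * ?P i)\<close> remains.\<close>
  have oo0: "?M (?T (Suc (2 * i)) * ?T (Suc (2 * j))) = 0 \<longleftrightarrow> i \<noteq> j" for i j
  proof (cases i j rule: linorder_cases)
    case less
    then show ?thesis unfolding mult.commute[of "?T (Suc (2 * i))"] oo KK by (simp add: low)
  next
    case equal
    then show ?thesis unfolding oo KK by (simp add: low eq u hP del: jacobi_poly.simps)
  next
    case greater
    then show ?thesis unfolding oo KK by (simp add: low)
  qed
  have "?M (?T i * ?T j) = 0 \<longleftrightarrow> i \<noteq> j" for i j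
  proof -
    obtain i' j' where "i = 2 * i' \<or> i = Suc (2 * i')" "j = 2 * j' \<or> j = Suc (2 * j')"
      by (metis oddE evenE Suc_eq_plus1)
    moreover have "2 * i' \<noteq> Suc (2 * j')" "Suc (2 * i') \<noteq> 2 * j'" by presburger+
    ultimately show ?thesis
      using ee[of i' j'] oe[of i' j'] oe[of j' i', unfolded mult.commute[of "?T (Suc (2 * j'))"]]
        oo0[of i' j'] hP[of i' j']
      by auto
  qed
  then show ?thesis
    unfolding monic_orthogonal_polys_def using jacobi_poly_monic by blast
qed

section \<open>The asymptotic expansion in sectors\<close>

lemma sector_square_distance:
  fixes z :: complex and t \<epsilon> :: real
  assumes "0 < \<epsilon>" "\<epsilon> < pi / 2" "\<epsilon> < Arg z" "Arg z < pi - \<epsilon>" "0 \<le> t"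
  shows "(sin \<epsilon> * cmod z)\<^sup>2 \<le> cmod (complex_of_real t - z\<^sup>2)"
proof -
  define s where "s = sqrt t"
  have s: "complex_of_real t = complex_of_real s ^ 2"
    using assms(5) by (simp add: s_def flip: of_real_power)
  \<comment> \<open>\<open>|t - z\<^sup>2| = |\<surd>t - z| |\<surd>t + z| \<ge> (Im z)\<^sup>2\<close>\<close>
  have "sin \<epsilon> \<le> sin (Arg z)"
  proof (cases "Arg z \<le> pi / 2")
    case True
    then show ?thesis using assms by (intro sin_monotone_2pi_le) auto
  next
    case False
    \<comment> \<open>Reflection at \<open>pi / 2\<close> keeps the sine and moves the angle to
      where the sine increases.\<close>
    then have "sin \<epsilon> \<le> sin (pi - Arg z)" using assms by (intro sin_monotone_2pi_le) auto
    then show ?thesis by simp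
  qed
  moreover have "Im z = cmod z * sin (Arg z)"
    by (metis Im_rcis rcis_cmod_Arg)
  ultimately have Im: "sin \<epsilon> * cmod z \<le> Im z"
    by (simp add: mult.commute mult_left_mono)
  have "0 \<le> sin \<epsilon> * cmod z"
    using assms by (intro mult_nonneg_nonneg sin_ge_zero) auto
  moreover have "Im z \<le> cmod (complex_of_real s - z)"
    using abs_Im_le_cmod[of "complex_of_real s - z"] by simp
  moreover have "Im z \<le> cmod (complex_of_real s + z)"
    using abs_Im_le_cmod[of "complex_of_real s + z"] by simp
  ultimately have "(sin \<epsilon> * cmod z) * (sin \<epsilon> * cmod z) \<le>
      cmod (complex_of_real s - z) * cmod (complex_of_real s + z)"
    using Im by (intro mult_mono) linarith+
  then show ?thesis
    unfolding s by (simp add: power2_eq_square norm_mult[symmetric] algebra_simps)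
qed

text \<open>The geometric expansion of the Cauchy kernel with its exact remainder; integration in
  \<open>t\<close> turns the sum into moments.\<close>

lemma geometric_remainder:
  fixes t w :: "'a :: field"
  assumes "w \<noteq> 0" "t \<noteq> w"
  shows "1 / (t - w) + (\<Sum>k\<le>n. t ^ k / w ^ (k + 1)) = t ^ (n + 1) / (w ^ (n + 1) * (t - w))"
proof (induction n)
  case 0
  show ?case using assms by (simp add: field_simps)
next
  case (Suc n)
  have "1 / (t - w) + (\<Sum>k\<le>Suc n. t ^ k / w ^ (k + 1)) =
      t ^ (n + 1) / (w ^ (n + 1) * (t - w)) + t ^ (n + 1) / w ^ (n + 2)"
    using Suc.IH by (simp add: add.assoc[symmetric])
  also have "\<dots> = t ^ (Suc n + 1) / (w ^ (Suc n + 1) * (t - w))"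
    using assms by (simp add: divide_simps) (simp add: algebra_simps)
  finally show ?case .
qed

text \<open>Integrating the geometric remainder leaves the next moment as error bound; \<delta>
  bounds the distance from \<open>w\<close> to the half-line [0, \<infinity>) from below.\<close>

lemma stieltjes_transform_remainder:
  assumes mu: "prob_space \<mu>" "sets \<mu> = sets borel" "\<And>j. integrable \<mu> (\<lambda>t. t ^ j)"
    and supp: "AE t in \<mu>. a \<le> t" "0 < a"
    and w: "w \<noteq> 0" and \<delta>: "0 < \<delta>" "\<And>t. 0 \<le> t \<Longrightarrow> \<delta> \<le> cmod (complex_of_real t - w)"
  shows "cmod (stieltjes_transform \<mu> a w + (\<Sum>k\<le>n. complex_of_real (moment \<mu> k) / w ^ (k + 1)))
    \<le> moment \<mu> (n + 1) / (\<delta> * cmod w ^ (n + 1))"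
proof -
  interpret prob_space \<mu> by fact
  define f where "f t = indicator {a..} t *\<^sub>R (1 / (complex_of_real t - w))" for t
  define g where "g t = (\<Sum>k\<le>n. complex_of_real (t ^ k) / w ^ (k + 1))" for t
  have meas: "f \<in> borel_measurable \<mu>"
    unfolding measurable_cong_sets[OF mu(2) refl] f_def by measurable
  \<comment> \<open>The indicator removes negative \<open>t\<close>, where \<delta> gives no
    control.\<close>
  have "norm (f t) \<le> 1 / \<delta>" for t
    using \<delta>(1) \<delta>(2)[of t] supp(2)
    by (auto simp: f_def indicator_def norm_divide intro!: divide_left_mono mult_pos_pos)
  then have f: "integrable \<mu> f"
    by (intro integrable_const_bound[where B = "1 / \<delta>"] meas) auto
  have g: "integrable \<mu> g"
    unfolding g_def by (intro Bochner_Integration.integrable_sum integrable_divide integrable_of_real mu(3))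
  have "(\<integral>t. g t \<partial>\<mu>) = (\<Sum>k\<le>n. complex_of_real (moment \<mu> k) / w ^ (k + 1))"
    unfolding g_def moment_def
    by (subst Bochner_Integration.integral_sum)
       (auto intro!: integrable_divide integrable_of_real mu(3) simp del: of_real_power)
  moreover have "(\<integral>t. f t \<partial>\<mu>) = stieltjes_transform \<mu> a w"
    by (simp add: stieltjes_transform_def set_lebesgue_integral_def f_def)
  ultimately have "stieltjes_transform \<mu> a w + (\<Sum>k\<le>n. complex_of_real (moment \<mu> k) / w ^ (k + 1))
      = (\<integral>t. f t + g t \<partial>\<mu>)"
    using f g by simp
  also have "cmod \<dots> \<le> (\<integral>t. norm (f t + g t) \<partial>\<mu>)"
    by (rule integral_norm_bound)
  also have "\<dots> \<le> (\<integral>t. t ^ (n + 1) / (\<delta> * cmod w ^ (n + 1)) \<partial>\<mu>)"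
  proof (rule integral_mono_AE)
    show "AE t in \<mu>. norm (f t + g t) \<le> t ^ (n + 1) / (\<delta> * cmod w ^ (n + 1))"
      using supp(1)
    proof eventually_elim
      case (elim t)
      then have t: "0 \<le> t" "complex_of_real t \<noteq> w"
        using supp(2) \<delta>(1) \<delta>(2)[of t] by auto
      have "f t + g t = complex_of_real t ^ (n + 1) / (w ^ (n + 1) * (complex_of_real t - w))"
        using geometric_remainder[OF w t(2), of n] elim by (simp add: f_def g_def)
      then have "norm (f t + g t) = t ^ (n + 1) / (cmod (complex_of_real t - w) * cmod w ^ (n + 1))"
        using t(1) by (simp add: norm_divide norm_mult norm_power mult_ac)
      also have "\<dots> \<le> t ^ (n + 1) / (\<delta> * cmod w ^ (n + 1))"
        using \<delta>(1) \<delta>(2)[OF t(1)] t(1) w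
        by (intro divide_left_mono mult_right_mono mult_pos_pos) auto
      finally show ?case .
    qed
  qed (use f g mu(3) in \<open>auto simp del: power_Suc\<close>)
  also have "\<dots> = moment \<mu> (n + 1) / (\<delta> * cmod w ^ (n + 1))"
    by (simp add: moment_def)
  finally show ?thesis .
qed

lemma inverse_power_smallo_at_infinity:
  assumes "n < k"
  shows "(\<lambda>z :: complex. 1 / z ^ k) \<in> o[at_infinity](\<lambda>z. 1 / z ^ n)"
proof (rule smalloI_tendsto)
  have "((\<lambda>z :: complex. inverse z ^ (k - n)) \<longlongrightarrow> 0 ^ (k - n)) at_infinity"
    by (intro tendsto_intros tendsto_inverse_0)
  then have "((\<lambda>z :: complex. inverse z ^ (k - n)) \<longlongrightarrow> 0) at_infinity"
    using assms by (simp add: power_0_left)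
  moreover have "\<forall>\<^sub>F z :: complex in at_infinity. inverse z ^ (k - n) = 1 / z ^ k / (1 / z ^ n)"
    using eventually_not_equal_at_infinity[of 0]
    by eventually_elim (use assms in \<open>simp add: power_diff field_simps\<close>)
  ultimately show "((\<lambda>z :: complex. 1 / z ^ k / (1 / z ^ n)) \<longlongrightarrow> 0) at_infinity"
    by (rule Lim_transform_eventually)
  show "\<forall>\<^sub>F z :: complex in at_infinity. 1 / z ^ n \<noteq> 0"
    using eventually_not_equal_at_infinity[of 0] by eventually_elim simp
qed

text \<open>In the factor z - \<alpha>, \<open>z\<close> produces the even moments and -\<alpha> the
  odd ones. So \<open>n + 1\<close> terms in z^2 become \<open>2 * n + 2\<close> terms in
  \<open>z\<close>.\<close>

lemma transformed_partial_sum: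
  fixes s m :: "nat \<Rightarrow> real" and z :: complex
  assumes "\<And>i. m (2 * i) = s i" "\<And>i. m (Suc (2 * i)) = - \<alpha> * s i" and "z \<noteq> 0"
  shows "(z - complex_of_real \<alpha>) * (\<Sum>k\<le>n. complex_of_real (s k) / (z\<^sup>2) ^ (k + 1)) =
    (\<Sum>j\<le>2 * n + 1. complex_of_real (m j) / z ^ (j + 1))"
proof (induction n)
  case 0
  show ?case using assms(1)[of 0] assms(2)[of 0] assms(3)
    by (simp add: field_simps power2_eq_square)
next
  case (Suc n)
  have "(\<Sum>j\<le>2 * Suc n + 1. complex_of_real (m j) / z ^ (j + 1)) =
      (\<Sum>j\<le>2 * n + 1. complex_of_real (m j) / z ^ (j + 1))
        + complex_of_real (s (Suc n)) / z ^ (2 * n + 3)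
        - complex_of_real \<alpha> * complex_of_real (s (Suc n)) / z ^ (2 * n + 4)"
    using assms(1)[of "Suc n"] assms(2)[of "Suc n"] by (simp add: eval_nat_numeral)
  moreover have "(z\<^sup>2) ^ (Suc n + 1) = z ^ (2 * n + 4)"
    unfolding power_mult[symmetric] by (rule arg_cong[where f = "\<lambda>k. z ^ k"]) simp
  moreover have "z ^ (2 * n + 4) = z * z ^ (2 * n + 3)"
    by (simp add: eval_nat_numeral)
  ultimately show ?case
    using Suc.IH assms(3) by (simp only: sum.atMost_Suc distrib_left)
      (simp add: left_diff_distrib diff_divide_distrib)
qed

text \<open>Truncating the expansion of \<open>stieltjes_transform\<close> after
  \<open>n + 1\<close> terms gives more terms in \<open>z\<close> than required. The surplus
  \<open>?tail\<close> and the error \<open>?R\<close>, which is O(1 / z^(2n+3)), are both o(1 /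
  z^(n+1)).\<close>

lemma sector_expansion_transformed:
  assumes mu: "prob_space \<mu>" "sets \<mu> = sets borel" "\<And>j. integrable \<mu> (\<lambda>t. t ^ j)"
    and supp: "AE t in \<mu>. a \<le> t" "0 < a"
    and m: "\<And>i. m (2 * i) = moment \<mu> i" "\<And>i. m (Suc (2 * i)) = - \<alpha> * moment \<mu> i"
  shows "sector_expansion (\<lambda>z. (z - complex_of_real \<alpha>) * stieltjes_transform \<mu> a (z\<^sup>2)) m"
  unfolding sector_expansion_def
proof (intro allI impI, elim conjE)
  fix \<epsilon> :: real and n :: nat
  assume \<epsilon>: "0 < \<epsilon>" "\<epsilon> < pi / 2"
  define F where "F = inf at_infinity (principal {z. \<epsilon> < Arg z \<and> Arg z < pi - \<epsilon>})"
  let ?S = "stieltjes_transform \<mu> a"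
  let ?R = "\<lambda>z. (z - complex_of_real \<alpha>) *
    (?S (z\<^sup>2) + (\<Sum>k\<le>n. complex_of_real (moment \<mu> k) / (z\<^sup>2) ^ (k + 1)))"
  let ?tail = "\<lambda>z. \<Sum>j\<in>{n<..2 * n + 1}. complex_of_real (m j) * (1 / z ^ (j + 1))"
  have small: "(\<lambda>z. 1 / z ^ k) \<in> o[F](\<lambda>z. 1 / z ^ (n + 1))" if "n + 1 < k" for k
    unfolding F_def using inverse_power_smallo_at_infinity[OF that]
    by (rule landau_o.small.filter_mono[rotated]) simp
  have sin: "sin \<epsilon> > 0" using \<epsilon> by (intro sin_gt_zero) auto
  define C where "C = moment \<mu> (n + 1) / (sin \<epsilon>)\<^sup>2"
  have "\<forall>\<^sub>F z in F. norm (?R z) \<le> ((1 + \<bar>\<alpha>\<bar>) * C) * norm (1 / z ^ (2 * n + 3))"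
    unfolding F_def eventually_inf_principal eventually_at_infinity
  \<comment> \<open>For |z| \<ge> 1 the factor z - \<alpha> is at most (1 + |\<alpha>|) |z|. It
    costs one power of the bound C / |z|^(2n+4), where two powers come from the distance and the
    rest from the geometric remainder.\<close>
  proof (intro exI[of _ 1] allI impI)
    fix z :: complex
    assume z: "1 \<le> norm z" "z \<in> {z. \<epsilon> < Arg z \<and> Arg z < pi - \<epsilon>}"
    then have z0: "z \<noteq> 0" by auto
    let ?D = "?S (z\<^sup>2) + (\<Sum>k\<le>n. complex_of_real (moment \<mu> k) / (z\<^sup>2) ^ (k + 1))"
    have "cmod ?D \<le> moment \<mu> (n + 1) / ((sin \<epsilon> * cmod z)\<^sup>2 * cmod (z\<^sup>2) ^ (n + 1))"
      using sin z z0 \<epsilon>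
      by (intro stieltjes_transform_remainder[OF mu supp] sector_square_distance) auto
    also have "\<dots> = C * (1 / cmod z ^ (2 * n + 4))"
    proof -
      have "(cmod z)\<^sup>2 * cmod (z\<^sup>2) ^ (n + 1) = cmod z ^ (2 * n + 4)"
        unfolding norm_power power_mult[symmetric] power_add[symmetric]
        by (rule arg_cong[where f = "\<lambda>k. cmod z ^ k"]) simp
      then show ?thesis by (simp add: C_def power_mult_distrib mult.assoc)
    qed
    finally have D: "cmod ?D \<le> C * (1 / cmod z ^ (2 * n + 4))" .
    have "cmod (z - complex_of_real \<alpha>) \<le> cmod z + \<bar>\<alpha>\<bar>"
      using norm_triangle_ineq4[of z "complex_of_real \<alpha>"] by simp
    also have "\<dots> \<le> (1 + \<bar>\<alpha>\<bar>) * cmod z"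
      using mult_left_mono[OF z(1), of "\<bar>\<alpha>\<bar>"] by (simp add: algebra_simps)
    finally have "cmod (z - complex_of_real \<alpha>) * cmod ?D
        \<le> ((1 + \<bar>\<alpha>\<bar>) * cmod z) * (C * (1 / cmod z ^ (2 * n + 4)))"
      using D by (intro mult_mono) auto
    also have "\<dots> = ((1 + \<bar>\<alpha>\<bar>) * C) * (cmod z / cmod z ^ (2 * n + 4))"
      by simp
    also have "cmod z / cmod z ^ (2 * n + 4) = norm (1 / z ^ (2 * n + 3))"
      using z0 by (simp add: norm_divide norm_power divide_simps) (simp add: eval_nat_numeral)
    finally show "norm (?R z) \<le> ((1 + \<bar>\<alpha>\<bar>) * C) * norm (1 / z ^ (2 * n + 3))"
      by (simp only: norm_mult)
  qed
  then have "?R \<in> O[F](\<lambda>z. 1 / z ^ (2 * n + 3))"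
    by (rule bigoI)
  also have "(\<lambda>z. 1 / z ^ (2 * n + 3)) \<in> o[F](\<lambda>z. 1 / z ^ (n + 1))"
    by (rule small) simp
  finally have R: "?R \<in> o[F](\<lambda>z. 1 / z ^ (n + 1))" .
  have tail: "?tail \<in> o[F](\<lambda>z. 1 / z ^ (n + 1))"
  proof (rule big_sum_in_smallo)
    fix j assume "j \<in> {n<..2 * n + 1}"
    then have "(\<lambda>z. 1 / z ^ (j + 1)) \<in> o[F](\<lambda>z. 1 / z ^ (n + 1))" by (intro small) auto
    then show "(\<lambda>z. complex_of_real (m j) * (1 / z ^ (j + 1))) \<in> o[F](\<lambda>z. 1 / z ^ (n + 1))"
      by (simp only: cmult_in_smallo_iff simp_thms)
  qed
  have "\<forall>\<^sub>F z in F. ?R z - ?tail z =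
      (z - complex_of_real \<alpha>) * ?S (z\<^sup>2) - (- (\<Sum>j\<le>n. complex_of_real (m j) / z ^ (j + 1)))"
    unfolding F_def eventually_inf_principal using eventually_not_equal_at_infinity[of 0]
  proof eventually_elim
    case (elim z)
    have "{..2 * n + 1} = {..n} \<union> {n<..2 * n + 1}" by auto
    then have "(\<Sum>j\<le>2 * n + 1. complex_of_real (m j) / z ^ (j + 1)) =
        (\<Sum>j\<le>n. complex_of_real (m j) / z ^ (j + 1)) + ?tail z"
      by (simp only: sum.union_disjoint[symmetric] finite_atMost finite_greaterThanAtMost
          ivl_disj_int times_divide_eq_right mult_1_right)
    then show ?case
      using transformed_partial_sum[where s = "moment \<mu>", OF m elim] by (simp add: distrib_left)
  qed
  then show "(\<lambda>z. (z - complex_of_real \<alpha>) * ?S (z\<^sup>2) -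
      (- (\<Sum>j\<le>n. complex_of_real (m j) / z ^ (j + 1)))) \<in>
      o[inf at_infinity (principal {z. \<epsilon> < Arg z \<and> Arg z < pi - \<epsilon>})](\<lambda>z. 1 / z ^ (n + 1))"
    unfolding F_def[symmetric] using sum_in_smallo(2)[OF R tail]
    by (rule landau_o.small.in_cong[THEN iffD1])
qed

section \<open>Evaluation at complex points, and assembly of the result\<close>

lemma poly_map_poly_of_real_add:
  "poly (map_poly complex_of_real (p + q)) x =
    poly (map_poly complex_of_real p) x + poly (map_poly complex_of_real q) x"
proof -
  have "map_poly complex_of_real (p + q) = map_poly complex_of_real p + map_poly complex_of_real q"
    by (simp add: poly_eq_iff coeff_map_poly)
  then show ?thesis by simp
qed

lemma poly_map_poly_of_real_smult:
  "poly (map_poly complex_of_real (Polynomial.smult c p)) x =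
    complex_of_real c * poly (map_poly complex_of_real p) x"
  by (subst map_poly_smult) auto

lemma poly_map_poly_of_real_mult:
  "poly (map_poly complex_of_real (p * q)) x =
    poly (map_poly complex_of_real p) x * poly (map_poly complex_of_real q) x"
  by (induction p)
     (simp_all add: map_poly_pCons poly_map_poly_of_real_add poly_map_poly_of_real_smult algebra_simps)

lemma poly_map_poly_of_real_pcompose_square:
  "poly (map_poly complex_of_real (pcompose p [:0, 0, 1:])) x =
    poly (map_poly complex_of_real p) (x\<^sup>2)"
  by (induction p)
     (simp_all add: map_poly_pCons pcompose_pCons power2_eq_square)

theorem theorem6p2:
  fixes a \<alpha> :: real and \<mu> :: "real measure" and J :: inf_matrix
  assumes "a > 0"
    and "nontrivial_prob_measure \<mu>"
    and "AE t in \<mu>. a \<le> t"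
    and "monic_jacobi_matrix J"
    and "monic_orthogonal_polys (moment \<mu>) (jacobi_poly J)"
    and "0 < \<alpha>" and "\<alpha> < sqrt a"
  shows "(\<forall>j. poly (jacobi_poly J j) (\<alpha>\<^sup>2) \<noteq> 0)
    \<and> (\<lambda>i k. gen_jacobi_matrix J i k - \<alpha> * inf_id i k)
        = inf_mult (L_factor J \<alpha>) (U_factor J \<alpha>)
    \<and> monic_jacobi_matrix_of (transformed_matrix J \<alpha>)
        (\<lambda>z. (z - complex_of_real \<alpha>) * stieltjes_transform \<mu> a (z\<^sup>2))
    \<and> (\<forall>j. jacobi_poly (transformed_matrix J \<alpha>) (2 * j)
            = pcompose (jacobi_poly J j) [:0, 0, 1:])
    \<and> (\<forall>j. jacobi_poly (transformed_matrix J \<alpha>) (2 * j + 1)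
            = [:\<alpha>, 1:] * pcompose (kernel_poly J \<alpha> j) [:0, 0, 1:])
    \<and> (\<forall>j x. x \<noteq> complex_of_real \<alpha> \<longrightarrow>
          poly (map_poly complex_of_real (jacobi_poly (transformed_matrix J \<alpha>) (2 * j + 1))) x
            = 1 / (x - complex_of_real \<alpha>) *
              (poly (map_poly complex_of_real (jacobi_poly J (j + 1))) (x\<^sup>2)
                - complex_of_real
                    (poly (jacobi_poly J (j + 1)) (\<alpha>\<^sup>2) / poly (jacobi_poly J j) (\<alpha>\<^sup>2))
                  * poly (map_poly complex_of_real (jacobi_poly J j)) (x\<^sup>2)))"
proof -
  have mu: "prob_space \<mu>" "sets \<mu> = sets borel" "\<And>j. integrable \<mu> (\<lambda>t. t ^ j)"
    using assms(2) unfolding nontrivial_prob_measure_def by blast+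
  have alpha: "\<alpha>\<^sup>2 < a"
    using assms(1,6,7) by (metis real_sqrt_less_iff real_sqrt_abs abs_of_pos)
  note nz = poly_jacobi_poly_nonzero[OF mu(3) assms(3,5) alpha]
  note u = u_coef_pos[OF mu(3) assms(3,5) alpha nz]
  let ?T = "transformed_matrix J \<alpha>"
  note T = jacobi_poly_transformed_matrix[OF nz]
  \<comment> \<open>These interleaved moments are the witness for the expansion demanded by
    \<open>monic_jacobi_matrix_of\<close>.\<close>
  define m where "m i = (if even i then moment \<mu> (i div 2) else - \<alpha> * moment \<mu> (i div 2))" for i
  have m: "m (2 * i) = moment \<mu> i" "m (Suc (2 * i)) = - \<alpha> * moment \<mu> i" for i
    by (simp_all add: m_def)
  have "monic_jacobi_matrix_of ?T (\<lambda>z. (z - complex_of_real \<alpha>) * stieltjes_transform \<mu> a (z\<^sup>2))"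
    unfolding monic_jacobi_matrix_of_def
    using monic_jacobi_transformed_matrix[OF u assms(4)]
      sector_expansion_transformed[OF mu assms(3,1) m]
      monic_orthogonal_polys_transformed_matrix[OF assms(5) nz m]
    by blast
  moreover have "poly (map_poly complex_of_real (jacobi_poly ?T (2 * j + 1))) x
      = 1 / (x - complex_of_real \<alpha>) *
        (poly (map_poly complex_of_real (jacobi_poly J (j + 1))) (x\<^sup>2)
          - complex_of_real (poly (jacobi_poly J (j + 1)) (\<alpha>\<^sup>2) / poly (jacobi_poly J j) (\<alpha>\<^sup>2))
            * poly (map_poly complex_of_real (jacobi_poly J j)) (x\<^sup>2))"
    if x: "x \<noteq> complex_of_real \<alpha>" for j x
  proof -
    let ?r = "poly (jacobi_poly J (Suc j)) (\<alpha>\<^sup>2) / poly (jacobi_poly J j) (\<alpha>\<^sup>2)"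
    let ?C = "\<lambda>p. poly (map_poly complex_of_real p)"
    have "[:- \<alpha>\<^sup>2, 1:] * kernel_poly J \<alpha> j =
        jacobi_poly J (Suc j) - Polynomial.smult ?r (jacobi_poly J j)"
      unfolding kernel_poly_mult[OF nz] by (simp add: u_coef_def del: jacobi_poly.simps)
    then have "[:- \<alpha>\<^sup>2, 1:] * kernel_poly J \<alpha> j + Polynomial.smult ?r (jacobi_poly J j)
        = jacobi_poly J (Suc j)"
      by (simp only: diff_add_cancel)
    then have "?C ([:- \<alpha>\<^sup>2, 1:] * kernel_poly J \<alpha> j + Polynomial.smult ?r (jacobi_poly J j)) (x\<^sup>2) =
        ?C (jacobi_poly J (Suc j)) (x\<^sup>2)"
      by (rule arg_cong)
    \<comment> \<open>Here x^2 - \<alpha>^2 is split as (x - \<alpha>) (x + \<alpha>), the second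
      factor belonging to the odd polynomial.\<close>
    then have "(x - complex_of_real \<alpha>) * ?C (jacobi_poly ?T (Suc (2 * j))) x =
        ?C (jacobi_poly J (Suc j)) (x\<^sup>2) - complex_of_real ?r * ?C (jacobi_poly J j) (x\<^sup>2)"
      unfolding T[THEN conjunct2] poly_map_poly_of_real_mult
        poly_map_poly_of_real_add poly_map_poly_of_real_smult poly_map_poly_of_real_pcompose_square
      by (simp add: map_poly_pCons algebra_simps power2_eq_square del: jacobi_poly.simps)
    then show ?thesis
      using x by (simp add: field_simps del: jacobi_poly.simps)
  qed
  ultimately show ?thesis
    using nz L_factor_mult_U_factor[OF nz] T
    by (intro conjI allI impI) (auto simp: fun_eq_iff simp del: jacobi_poly.simps)
qed

end
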